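(* Let $n\ge 1$, let $\beta>0$ be fixed, and let $\alpha_k,\alpha^*_k>0$ for $k=1,\ldots,n$. Let $X_1,\ldots,X_n$ be independent random variables with $X_k\sim \mathcal{LFR}(\alpha_k,\beta)$, and let $Y_1,\ldots,Y_n$ be independent random variables with $Y_k\sim \mathcal{LFR}(\alpha^*_k,\beta)$, $k=1,\ldots,n$. If $\alpha^*_k>\alpha_k$ for every $k=1,\ldots,n$, then $X_{1:n}\le_{*}Y_{1:n}$.
   Context: For $\alpha,\beta>0$, a random variable $X$ has the linear failure rate distribution, written $X\sim\mathcal{LFR}(\alpha,\beta)$, if its cumulative distribution function is $F_X(x)=1-\exp\{-(\alpha x+\frac{\beta}{2}x^2)\}$ for $x>0$ (and $0$ for $x\le 0$). $X_{1:n}=\min\{X_1,\ldots,X_n\}$ and $Y_{1:n}=\min\{Y_1,\ldots,Y_n\}$ denote the smallest order statistics (lifetimes of series systems). For nonnegative absolutely continuous random variables $X,Y$ with cumulative distribution functions $F_X,G_Y$ and quantile functions $F_X^{-1},G_Y^{-1}$, the star order $X\le_{*}Y$ means that $G_Y^{-1}(F_X(x))/x$ is increasing (i.e. non-decreasing) in $x>0$; equivalently, $G_Y^{-1}(p)/F_X^{-1}(p)$ is increasing in $p\in(0,1)$. *)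

theory Defs
  imports "HOL-Probability.Probability"
begin

definition lfr_cdf :: "real \<Rightarrow> real \<Rightarrow> real \<Rightarrow> real" where
  "lfr_cdf \<alpha> \<beta> x = (if x > 0 then 1 - exp (- (\<alpha> * x + \<beta> / 2 * x\<^sup>2)) else 0)"

definition lfr_distributed :: "'a measure \<Rightarrow> ('a \<Rightarrow> real) \<Rightarrow> real \<Rightarrow> real \<Rightarrow> bool" where
  "lfr_distributed M X \<alpha> \<beta> \<longleftrightarrow>
     X \<in> borel_measurable M \<and> (\<forall>x. cdf (distr M borel X) x = lfr_cdf \<alpha> \<beta> x)"

text \<open>
  The infimum is over a nonempty set that is bounded below whenever \<open>0 < p < 1\<close>;
  for other \<open>p\<close> the value is not meaningful.
\<close>

definition quantile :: "'a measure \<Rightarrow> ('a \<Rightarrow> real) \<Rightarrow> real \<Rightarrow> real" where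
  "quantile M X p = Inf {x. p \<le> cdf (distr M borel X) x}"

definition nonneg_abs_cont :: "'a measure \<Rightarrow> ('a \<Rightarrow> real) \<Rightarrow> bool" where
  "nonneg_abs_cont M X \<longleftrightarrow>
     X \<in> borel_measurable M \<and> (AE \<omega> in M. 0 \<le> X \<omega>) \<and>
     absolutely_continuous lborel (distr M borel X)"

text \<open>
  The star order depends only on the two laws, so \<open>X\<close> and \<open>Y\<close> may live on different
  probability spaces. Since the quantile function of \<open>Y\<close> has domain \<open>(0, 1)\<close>, the
  monotonicity is required at those \<open>x > 0\<close> where \<open>F\<^sub>X x\<close> lies in \<open>(0, 1)\<close>; this is every
  \<open>x > 0\<close> if \<open>X\<close> has a linear failure rate distribution or is the minimum of finitely many
  independent such variables.
\<close>

definition star_order ::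
  "'a measure \<Rightarrow> ('a \<Rightarrow> real) \<Rightarrow> 'b measure \<Rightarrow> ('b \<Rightarrow> real) \<Rightarrow> bool" where
  "star_order M X N Y \<longleftrightarrow>
     nonneg_abs_cont M X \<and> nonneg_abs_cont N Y \<and>
     mono_on {x. 0 < x \<and> cdf (distr M borel X) x \<in> {0<..<1}}
       (\<lambda>x. quantile N Y (cdf (distr M borel X) x) / x)"

definition min_order_stat :: "nat \<Rightarrow> (nat \<Rightarrow> 'a \<Rightarrow> real) \<Rightarrow> 'a \<Rightarrow> real" where
  "min_order_stat n X \<omega> = Min ((\<lambda>k. X k \<omega>) ` {1..n})"

end

theory Submission
  imports Defs
begin

text \<open>
  Survival functions of independent variables multiply under minima, so both minima are again
  linear failure rate variables, with parameters \<open>(a, n \<beta>)\<close> and \<open>(a', n \<beta>)\<close> where \<open>a < a'\<close> are the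
  sums of the \<open>\<alpha> k\<close> and \<open>\<alpha>' k\<close>. With \<open>c = n \<beta> / 2\<close>, equality of the two distribution functions at
  \<open>x\<close> and \<open>r x\<close> means \<open>a' r - a = c x (1 - r\<^sup>2)\<close>, which forces \<open>r \<le> 1\<close>; if \<open>r\<close> decreased while
  \<open>x\<close> grew, the left-hand side would decrease while the right-hand side would not.
\<close>

text \<open>On the positive axis the cumulative hazard
  \<open>\<alpha> * t + \<beta> / 2 * t\<^sup>2\<close> increases strictly. For
  \<open>z \<le> 0\<close> the right-hand value is 0, below the positive value at \<open>y\<close>.
  Leaving the sign of \<open>z\<close> open is what quantiles require, since their infimum ranges
  over all reals.\<close>

lemma lfr_cdf_le_iff:
  assumes "\<alpha> > 0" "\<beta> > 0" "y > 0"
  shows "lfr_cdf \<alpha> \<beta> y \<le> lfr_cdf \<alpha> \<beta> z \<longleftrightarrow> y \<le> z"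
proof (cases "z > 0")
  case True
  have "\<alpha> * s + \<beta> / 2 * s\<^sup>2 < \<alpha> * t + \<beta> / 2 * t\<^sup>2" if "0 < s" "s < t" for s t
  proof -
    have "s\<^sup>2 \<le> t\<^sup>2" using that by (intro power_mono) auto
    then show ?thesis
      using that assms by (intro add_less_le_mono mult_strict_left_mono mult_left_mono) auto
  qed
  from this[of y z] this[of z y] show ?thesis
    using True assms by (cases y z rule: linorder_cases) (auto simp: lfr_cdf_def)
next
  case False
  have "0 < \<alpha> * y + \<beta> / 2 * y\<^sup>2" using assms by (intro add_pos_pos mult_pos_pos) auto
  then show ?thesis using False assms by (auto simp: lfr_cdf_def)
qed

lemma lfr_quantile:
  assumes "\<alpha> > 0" "\<beta> > 0" "y > 0"
    and "\<And>x. cdf (distr M borel X) x = lfr_cdf \<alpha> \<beta> x"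
  shows "quantile M X (lfr_cdf \<alpha> \<beta> y) = y"
proof -
  have "{x. lfr_cdf \<alpha> \<beta> y \<le> cdf (distr M borel X) x} = {y..}"
    using assms by (auto simp: lfr_cdf_le_iff)
  then show ?thesis by (simp add: quantile_def)
qed

text \<open>Hazard rate times survival function, which is the derivative of \<open>lfr_cdf\<close>
  on the positive axis.\<close>

definition lfr_density :: "real \<Rightarrow> real \<Rightarrow> real \<Rightarrow> real" where
  "lfr_density \<alpha> \<beta> x = (\<alpha> + \<beta> * x) * exp (- (\<alpha> * x + \<beta> / 2 * x\<^sup>2)) * indicator {0..} x"

lemma lfr_density_measurable [measurable]: "lfr_density \<alpha> \<beta> \<in> borel_measurable borel"
  unfolding lfr_density_def by measurable

lemma nn_integral_lfr_density_atMost: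
  assumes "\<alpha> > 0" "\<beta> > 0"
  shows "(\<integral>\<^sup>+t. ennreal (lfr_density \<alpha> \<beta> t * indicator {..x} t) \<partial>lborel) = lfr_cdf \<alpha> \<beta> x"
proof (cases "x > 0")
  case True
  have "(\<integral>\<^sup>+t. ennreal (lfr_density \<alpha> \<beta> t * indicator {..x} t) \<partial>lborel) =
      (\<integral>\<^sup>+t. ennreal ((\<alpha> + \<beta> * t) * exp (- (\<alpha> * t + \<beta> / 2 * t\<^sup>2))) * indicator {0..x} t \<partial>lborel)"
    by (intro nn_integral_cong) (auto simp: lfr_density_def split: split_indicator)
  \<comment> \<open>The antiderivative is minus the survival function.\<close>
  also have "\<dots> = ennreal ((- exp (- (\<alpha> * x + \<beta> / 2 * x\<^sup>2))) - (- exp (- (\<alpha> * 0 + \<beta> / 2 * 0\<^sup>2))))"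
    by (rule nn_integral_FTC_Icc)
      (use assms True in \<open>auto intro!: derivative_eq_intros simp: algebra_simps power2_eq_square\<close>)
  finally show ?thesis using True by (simp add: lfr_cdf_def)
next
  case False
  \<comment> \<open>For \<open>x = 0\<close> the integrand is still \<alpha> at the single point 0,
    so it vanishes only almost everywhere.\<close>
  have "AE t in lborel. t \<noteq> (0::real)" by (rule AE_lborel_singleton)
  then have "AE t in lborel. ennreal (lfr_density \<alpha> \<beta> t * indicator {..x} t) = 0"
    by eventually_elim (use False in \<open>auto simp: lfr_density_def split: split_indicator\<close>)
  then show ?thesis using False by (simp add: nn_integral_zero' lfr_cdf_def)
qed

text \<open>A law on the reals is determined by its values on the half-lines \<open>{..a}\<close>,
  and there the integral of the density is already known. Nonnegativity and absolute continuity can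
  then be read off the density.\<close>

lemma (in prob_space) lfr_distributed_density:
  assumes pos: "\<alpha> > 0" "\<beta> > 0" and lfr: "lfr_distributed M X \<alpha> \<beta>"
  shows "distributed M lborel X (lfr_density \<alpha> \<beta>)"
proof (rule distributedI_borel_atMost)
  show X: "X \<in> borel_measurable M" using lfr by (simp add: lfr_distributed_def)
  show "AE x in lborel. 0 \<le> lfr_density \<alpha> \<beta> x"
    using pos by (auto simp: lfr_density_def split: split_indicator)
  show "emeasure M {\<omega> \<in> space M. X \<omega> \<le> a} = ennreal (lfr_cdf \<alpha> \<beta> a)" for a
  proof -
    have "{\<omega> \<in> space M. X \<omega> \<le> a} = X -` {..a} \<inter> space M" by auto
    then have "prob {\<omega> \<in> space M. X \<omega> \<le> a} = cdf (distr M borel X) a"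
      using X by (simp add: cdf_def measure_distr)
    then show ?thesis using lfr by (simp add: emeasure_eq_measure lfr_distributed_def)
  qed
qed (simp_all add: nn_integral_lfr_density_atMost pos)

lemma (in prob_space) lfr_nonneg_abs_cont:
  assumes "\<alpha> > 0" "\<beta> > 0" and "lfr_distributed M X \<alpha> \<beta>"
  shows "nonneg_abs_cont M X"
proof -
  have X: "X \<in> borel_measurable M" using assms by (simp add: lfr_distributed_def)
  \<comment> \<open>The density fact speaks of \<open>distr M lborel X\<close>; the two image
    measures agree because \<open>borel\<close> and \<open>lborel\<close> have the same measurable
    sets.\<close>
  have D: "distr M borel X = density lborel (lfr_density \<alpha> \<beta>)"
    using distributed_distr_eq_density[OF lfr_distributed_density[OF assms]]
    by (simp cong: distr_cong)
  have "AE x in distr M borel X. 0 \<le> x"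
    unfolding D by (subst AE_density) (auto simp: lfr_density_def split: split_indicator)
  then have "AE \<omega> in M. 0 \<le> X \<omega>"
    using X by (subst (asm) AE_distr_iff) auto
  moreover have "absolutely_continuous lborel (distr M borel X)"
    unfolding D by (rule absolutely_continuousI_density) simp
  ultimately show ?thesis using X by (simp add: nonneg_abs_cont_def)
qed

lemma (in prob_space) cdf_min_order_stat:
  assumes n: "n \<ge> 1" and indep: "indep_vars (\<lambda>_. borel) X {1..n}"
  shows "1 - cdf (distr M borel (min_order_stat n X)) x =
    (\<Prod>k=1..n. 1 - cdf (distr M borel (X k)) x)"
    and min_order_stat_measurable: "min_order_stat n X \<in> borel_measurable M"
proof -
  have X: "X k \<in> borel_measurable M" if "k \<in> {1..n}" for k
    using indep that by (auto simp: indep_vars_def)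
  show meas: "min_order_stat n X \<in> borel_measurable M"
    unfolding min_order_stat_def[abs_def] using X n by (intro borel_measurable_Min) auto
  have surv: "1 - cdf (distr M borel Z) x = prob (Z -` {x<..} \<inter> space M)"
    if Z: "Z \<in> borel_measurable M" for Z
  proof -
    interpret D: prob_space "distr M borel Z" using Z by (rule prob_space_distr)
    have "1 - cdf (distr M borel Z) x = measure (distr M borel Z) (- {..x})"
      unfolding cdf_def by (subst D.prob_compl[symmetric]) (auto simp: Compl_eq_Diff_UNIV)
    also have "- {..x} = {x<..}" by auto
    finally show ?thesis using Z by (simp add: measure_distr)
  qed
  \<comment> \<open>The minimum exceeds \<open>x\<close> exactly when every variable does;
    \<open>n \<ge> 1\<close> makes \<open>Min\<close> range over a nonempty set. Independence then
    turns the intersection into a product.\<close>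
  have "min_order_stat n X -` {x<..} \<inter> space M = (\<Inter>k\<in>{1..n}. X k -` {x<..} \<inter> space M)"
    using n by (auto simp: min_order_stat_def)
  also have "prob \<dots> = (\<Prod>k=1..n. prob (X k -` {x<..} \<inter> space M))"
    using n by (intro indep_varsD[OF indep]) auto
  finally show "1 - cdf (distr M borel (min_order_stat n X)) x =
      (\<Prod>k=1..n. 1 - cdf (distr M borel (X k)) x)"
    using X by (simp add: surv meas)
qed

lemma (in prob_space) min_order_stat_lfr:
  assumes n: "n \<ge> 1" and indep: "indep_vars (\<lambda>_. borel) X {1..n}"
    and lfr: "\<And>k. k \<in> {1..n} \<Longrightarrow> lfr_distributed M (X k) (\<alpha> k) \<beta>"
  shows "lfr_distributed M (min_order_stat n X) (\<Sum>k=1..n. \<alpha> k) (real n * \<beta>)"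
proof -
  have "cdf (distr M borel (min_order_stat n X)) x = lfr_cdf (\<Sum>k=1..n. \<alpha> k) (real n * \<beta>) x" for x
  proof -
    have "1 - cdf (distr M borel (min_order_stat n X)) x = (\<Prod>k=1..n. 1 - lfr_cdf (\<alpha> k) \<beta> x)"
      unfolding cdf_min_order_stat[OF n indep]
      using lfr by (intro prod.cong) (auto simp: lfr_distributed_def)
    \<comment> \<open>For \<open>x > 0\<close> the exponents add up, each factor contributing one
      \<beta>; for \<open>x \<le> 0\<close> both sides are 1.\<close>
    also have "\<dots> = 1 - lfr_cdf (\<Sum>k=1..n. \<alpha> k) (real n * \<beta>) x"
      by (simp add: lfr_cdf_def exp_sum[symmetric] sum.distrib sum_negf sum_distrib_right
          sum_subtractf)
    finally show ?thesis by simp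
  qed
  then show ?thesis
    using min_order_stat_measurable[OF n indep] by (simp add: lfr_distributed_def)
qed

text \<open>Here \<open>r\<close> and \<open>r'\<close> stand for the quotients (quantile over
  argument) at \<open>x\<close> and \<open>x'\<close>, and the two equations say that the cumulative
  hazards agree.\<close>

lemma lfr_equal_cdf_ratio_mono:
  fixes a a' c :: real
  assumes a: "a \<le> a'" and a0: "a' > 0" and c: "c > 0" and x: "0 < x" "x \<le> x'"
    and r: "r > 0" and r': "r' > 0"
    and eq: "a' * (r * x) + c * (r * x)\<^sup>2 = a * x + c * x\<^sup>2"
    and eq': "a' * (r' * x') + c * (r' * x')\<^sup>2 = a * x' + c * x'\<^sup>2"
  shows "r \<le> r'"
proof (rule ccontr)
  have red: "a' * s - a = c * t * (1 - s\<^sup>2)"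
    if "t > 0" "a' * (s * t) + c * (s * t)\<^sup>2 = a * t + c * t\<^sup>2" for s t
  proof -
    have "t * (a' * s - a) = t * (c * t * (1 - s\<^sup>2))"
      using that by (simp add: algebra_simps power2_eq_square)
    then show ?thesis using that by simp
  qed
  have R: "a' * r - a = c * x * (1 - r\<^sup>2)" using red[OF x(1) eq] .
  have R': "a' * r' - a = c * x' * (1 - r'\<^sup>2)" using red[OF _ eq'] x by simp
  \<comment> \<open>If \<open>r > 1\<close>, the right side of \<open>R\<close> is negative, while
    the left side is at least \<open>a' - a \<ge> 0\<close>.\<close>
  have "r \<le> 1"
  proof (rule ccontr)
    assume "\<not> r \<le> 1"
    then have "1 - r\<^sup>2 < 0" by simp
    then have "c * x * (1 - r\<^sup>2) < 0" using c x by (intro mult_pos_neg) auto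
    moreover have "a' * r \<ge> a' * 1" using \<open>\<not> r \<le> 1\<close> a0 by (intro mult_left_mono) auto
    ultimately show False using R a by simp
  qed
  assume "\<not> r \<le> r'"
  then have lt: "r' < r" by simp
  then have "r'\<^sup>2 \<le> r\<^sup>2" using r' by (intro power_mono) auto
  moreover have "r\<^sup>2 \<le> 1" using \<open>r \<le> 1\<close> r by (simp add: power_le_one)
  \<comment> \<open>Both factors grow, and \<open>1 - r\<^sup>2\<close> is nonnegative by
    \<open>r \<le> 1\<close>, so the products compare.\<close>
  ultimately have "c * x * (1 - r\<^sup>2) \<le> c * x' * (1 - r'\<^sup>2)"
    using c x by (intro mult_mono) auto
  moreover have "a' * r' < a' * r" using lt a0 by simp
  ultimately show False using R R' by simp
qed

lemma quadratic_hazard_solution: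
  fixes a c h :: real
  assumes "a > 0" "c > 0" "h > 0"
  obtains y where "y > 0" "a * y + c * y\<^sup>2 = h"
proof -
  \<comment> \<open>At \<open>h / a\<close> the linear term alone already reaches
    \<open>h\<close>.\<close>
  have "\<exists>y\<ge>0. y \<le> h / a \<and> a * y + c * y\<^sup>2 = h"
    using assms by (intro IVT'[where f = "\<lambda>y. a * y + c * y\<^sup>2"])
      (auto intro!: continuous_intros)
  then obtain y where y: "y \<ge> 0" "a * y + c * y\<^sup>2 = h" by auto
  moreover have "y \<noteq> 0" using y assms by auto
  ultimately show ?thesis using that[of y] by simp
qed

lemma lfr_star_order:
  assumes "prob_space M" "prob_space N"
    and X: "lfr_distributed M X \<alpha> \<beta>" and Y: "lfr_distributed N Y \<alpha>' \<beta>"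
    and \<alpha>: "\<alpha> > 0" and le: "\<alpha> \<le> \<alpha>'" and \<beta>: "\<beta> > 0"
  shows "star_order M X N Y"
proof -
  have \<alpha>': "\<alpha>' > 0" using \<alpha> le by simp
  have FX: "cdf (distr M borel X) x = lfr_cdf \<alpha> \<beta> x"
    and FY: "cdf (distr N borel Y) x = lfr_cdf \<alpha>' \<beta> x" for x
    using X Y by (auto simp: lfr_distributed_def)
  \<comment> \<open>The witness is \<open>r = y / x\<close>, where \<open>y\<close> is the point at
    which the cumulative hazard of \<open>Y\<close> equals that of \<open>X\<close> at
    \<open>x\<close>. The distribution functions then agree there, so \<open>y\<close> is the
    quantile.\<close>
  have ratio: "\<exists>r>0. \<alpha>' * (r * x) + \<beta> / 2 * (r * x)\<^sup>2 = \<alpha> * x + \<beta> / 2 * x\<^sup>2 \<and>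
      quantile N Y (lfr_cdf \<alpha> \<beta> x) / x = r" if x: "x > 0" for x
  proof -
    have "\<alpha> * x + \<beta> / 2 * x\<^sup>2 > 0" using x \<alpha> \<beta> by (simp add: add_pos_pos)
    then obtain y where y: "y > 0" "\<alpha>' * y + \<beta> / 2 * y\<^sup>2 = \<alpha> * x + \<beta> / 2 * x\<^sup>2"
      using quadratic_hazard_solution[of \<alpha>' "\<beta> / 2"] \<alpha>' \<beta> by auto
    have "lfr_cdf \<alpha> \<beta> x = lfr_cdf \<alpha>' \<beta> y" using x y by (simp add: lfr_cdf_def)
    then have "quantile N Y (lfr_cdf \<alpha> \<beta> x) = y"
      using lfr_quantile[OF \<alpha>' \<beta> y(1) FY] by simp
    then show ?thesis using x y by (intro exI[of _ "y / x"]) simp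
  qed
  have "mono_on {x. 0 < x \<and> lfr_cdf \<alpha> \<beta> x \<in> {0<..<1}}
      (\<lambda>x. quantile N Y (lfr_cdf \<alpha> \<beta> x) / x)"
  proof (rule mono_onI)
    fix x x' :: real
    assume "x \<in> {x. 0 < x \<and> lfr_cdf \<alpha> \<beta> x \<in> {0<..<1}}"
      and "x' \<in> {x. 0 < x \<and> lfr_cdf \<alpha> \<beta> x \<in> {0<..<1}}" and "x \<le> x'"
    then have x: "0 < x" "0 < x'" "x \<le> x'" by auto
    show "quantile N Y (lfr_cdf \<alpha> \<beta> x) / x \<le> quantile N Y (lfr_cdf \<alpha> \<beta> x') / x'"
      using ratio[OF x(1)] ratio[OF x(2)]
        lfr_equal_cdf_ratio_mono[OF le \<alpha>' _ x(1,3), of "\<beta> / 2"] \<beta> by auto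
  qed
  moreover have "nonneg_abs_cont M X" "nonneg_abs_cont N Y"
    using prob_space.lfr_nonneg_abs_cont[OF assms(1) \<alpha> \<beta> X]
      prob_space.lfr_nonneg_abs_cont[OF assms(2) \<alpha>' \<beta> Y] by auto
  ultimately show ?thesis by (simp add: star_order_def FX)
qed

theorem theorem4p2:
  fixes M :: "'a measure" and N :: "'b measure"
    and X :: "nat \<Rightarrow> 'a \<Rightarrow> real" and Y :: "nat \<Rightarrow> 'b \<Rightarrow> real"
    and \<alpha> \<alpha>' :: "nat \<Rightarrow> real" and \<beta> :: real and n :: nat
  assumes "n \<ge> 1"
    and "\<beta> > 0"
    and "\<And>k. k \<in> {1..n} \<Longrightarrow> \<alpha> k > 0"
    and "\<And>k. k \<in> {1..n} \<Longrightarrow> \<alpha>' k > 0"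
    and "prob_space M"
    and "prob_space N"
    and "prob_space.indep_vars M (\<lambda>_. borel) X {1..n}"
    and "prob_space.indep_vars N (\<lambda>_. borel) Y {1..n}"
    and "\<And>k. k \<in> {1..n} \<Longrightarrow> lfr_distributed M (X k) (\<alpha> k) \<beta>"
    and "\<And>k. k \<in> {1..n} \<Longrightarrow> lfr_distributed N (Y k) (\<alpha>' k) \<beta>"
    and "\<And>k. k \<in> {1..n} \<Longrightarrow> \<alpha>' k > \<alpha> k"
  shows "star_order M (min_order_stat n X) N (min_order_stat n Y)"
proof (rule lfr_star_order)
  show "lfr_distributed M (min_order_stat n X) (\<Sum>k=1..n. \<alpha> k) (real n * \<beta>)"
    by (intro prob_space.min_order_stat_lfr assms)
  show "lfr_distributed N (min_order_stat n Y) (\<Sum>k=1..n. \<alpha>' k) (real n * \<beta>)"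
    by (intro prob_space.min_order_stat_lfr assms)
  \<comment> \<open>\<open>n \<ge> 1\<close> makes the sum nonempty, hence positive.\<close>
  show "(\<Sum>k=1..n. \<alpha> k) > 0" using assms(1,3) by (intro sum_pos) auto
  show "(\<Sum>k=1..n. \<alpha> k) \<le> (\<Sum>k=1..n. \<alpha>' k)"
    using assms(11) by (intro sum_mono less_imp_le) auto
  show "real n * \<beta> > 0" using assms(1,2) by simp
qed fact+

end
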